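(* Let $i \ge 3$ be an integer, let $p$ be an odd positive integer, let $G$ be a graph, and let $H$ be an induced subgraph of $G$ that is a $K_i$-$p$-hole. Let $I$ be the ideal of the $K_i$-free problem on $G$. Then the $K_i$-$p$-hole inequality $$\frac{p-1}{2}(2i-3) + i-2 - \sum_{K \in \mathbf{K}_{i-1}(H)} x_K \ \ge\ 0$$ is $\lceil i/2 \rceil$-sos mod $I$; that is, the linear polynomial on its left-hand side is $\lceil i/2 \rceil$-sos mod $I$.
   Context: For a graph $G$, $\mathbf{K}_j(G)$ denotes the collection of cliques of size $j$ in $G$, and $K_j$ denotes the complete graph on $j$ vertices. A set $C \subseteq \mathbf{K}_{i-1}(G)$ is $K_i$-free if for every $K \in \mathbf{K}_i(G)$ there is some $L \in \mathbf{K}_{i-1}(G)$ with $L \subset K$ and $L \notin C$. The ideal $I$ of the $K_i$-free problem on $G$ is the vanishing ideal, in the polynomial ring $\mathbb{R}[x_K : K \in \mathbf{K}_{i-1}(G)]$, of the set of characteristic vectors in $\{0,1\}^{\mathbf{K}_{i-1}(G)}$ of the $K_i$-free subsets of $\mathbf{K}_{i-1}(G)$. A polynomial $f$ is $k$-sos mod $I$ if there are polynomials $g_1,\dots,g_m$ of degree at most $k$ with $f - \sum_{j=1}^m g_j^2 \in I$. A graph $H$ is a $K_i$-$p$-hole if $H$ is the union of $G_1,\dots,G_p$, each a copy of $K_i$, where (for $j \ne l$) $G_j$ and $G_l$ share a common $K_{i-1}$ if and only if $j - l \equiv \pm 1 \pmod p$.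
   Formalization: Added hypothesis: H has exactly p(i-1) cliques of size i-1. Without it the claim fails, e.g. p=1 with H=K_i (constant i-2, but i-1 cliques can be chosen), or three triangles on one common edge (i=p=3: constant 4, maximum 6). *)

theory Defs
  imports
    Complex_Main
    "HOL-Number_Theory.Cong"
    "HOL-Library.Poly_Mapping"
    "Graph_Theory.Graph_Theory"
begin

section \<open>Polynomials in several variables\<close>

text \<open>
  A monomial maps each variable to its exponent, and a polynomial maps each monomial to its
  coefficient, both with finite support.  The ring structure (convolution product) is the
  one of \<^theory>\<open>HOL-Library.Poly_Mapping\<close>.
\<close>

type_synonym 'v mpoly = "('v \<Rightarrow>\<^sub>0 nat) \<Rightarrow>\<^sub>0 real"

definition mpoly_const :: "real \<Rightarrow> 'v mpoly" where
  "mpoly_const c = Poly_Mapping.single 0 c"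

definition mpoly_var :: "'v \<Rightarrow> 'v mpoly" where
  "mpoly_var v = Poly_Mapping.single (Poly_Mapping.single v 1) 1"

definition mpoly_ring :: "'v set \<Rightarrow> 'v mpoly set" where
  "mpoly_ring X = {f. \<forall>m \<in> Poly_Mapping.keys f. Poly_Mapping.keys m \<subseteq> X}"

definition mpoly_eval :: "('v \<Rightarrow> real) \<Rightarrow> 'v mpoly \<Rightarrow> real" where
  "mpoly_eval a f =
    (\<Sum>m \<in> Poly_Mapping.keys f. Poly_Mapping.lookup f m *
      (\<Prod>v \<in> Poly_Mapping.keys m. a v ^ Poly_Mapping.lookup m v))"

text \<open>The total degree; the zero polynomial is given degree 0.\<close>

definition total_degree :: "'v mpoly \<Rightarrow> nat" where
  "total_degree f =
    Max (insert 0 ((\<lambda>m. \<Sum>v \<in> Poly_Mapping.keys m. Poly_Mapping.lookup m v)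
                     ` Poly_Mapping.keys f))"

definition sos_mod :: "nat \<Rightarrow> 'v set \<Rightarrow> 'v mpoly set \<Rightarrow> 'v mpoly \<Rightarrow> bool" where
  "sos_mod k X I f \<longleftrightarrow>
    (\<exists>gs. set gs \<subseteq> mpoly_ring X \<and> (\<forall>g \<in> set gs. total_degree g \<le> k) \<and>
          f - (\<Sum>g\<leftarrow>gs. g\<^sup>2) \<in> I)"


section \<open>Cliques and the clique-free problem\<close>

text \<open>
  Simple graphs are the finite symmetric loopless digraphs without parallel arcs (locale
  \<^locale>\<open>graph\<close>).  A clique is represented by its vertex set, so that a clique of a
  subgraph of \<open>G\<close> is literally a clique of \<open>G\<close>.
\<close>

definition cliques :: "nat \<Rightarrow> ('a, 'b) pre_digraph \<Rightarrow> 'a set set" where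
  "cliques j G = {S. S \<subseteq> verts G \<and> complete_digraph j (G \<restriction> S)}"

definition clique_free :: "nat \<Rightarrow> ('a, 'b) pre_digraph \<Rightarrow> 'a set set \<Rightarrow> bool" where
  "clique_free i G C \<longleftrightarrow>
    C \<subseteq> cliques (i - 1) G \<and>
    (\<forall>K \<in> cliques i G. \<exists>L \<in> cliques (i - 1) G. L \<subset> K \<and> L \<notin> C)"

definition char_vec :: "'v set \<Rightarrow> 'v \<Rightarrow> real" where
  "char_vec C v = (if v \<in> C then 1 else 0)"

definition clique_free_ideal :: "nat \<Rightarrow> ('a, 'b) pre_digraph \<Rightarrow> 'a set mpoly set" where
  "clique_free_ideal i G =
    {f \<in> mpoly_ring (cliques (i - 1) G).
       \<forall>C. clique_free i G C \<longrightarrow> mpoly_eval (char_vec C) f = 0}"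


section \<open>Clique holes\<close>

definition clique_hole :: "nat \<Rightarrow> nat \<Rightarrow> ('a, 'b) pre_digraph \<Rightarrow> bool" where
  "clique_hole i p H \<longleftrightarrow>
    (\<exists>Q :: nat \<Rightarrow> ('a, 'b) pre_digraph.
      (\<forall>j \<in> {1..p}. subgraph (Q j) H \<and> complete_digraph i (Q j)) \<and>
      H = pre_digraph.Union H (Q ` {1..p}) \<and>
      (\<forall>j \<in> {1..p}. \<forall>l \<in> {1..p}. j \<noteq> l \<longrightarrow>
        (cliques (i - 1) (Q j) \<inter> cliques (i - 1) (Q l) \<noteq> {} \<longleftrightarrow>
         [int j - int l = 1] (mod int p) \<or> [int j - int l = - 1] (mod int p))))"

text \<open>
  A cyclic chain of \<open>p\<close> copies of \<open>K\<^sub>i\<close> in which neighbouring copies are glued along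
  pairwise different \<open>K\<^sub>i\<^sub>-\<^sub>1\<close>'s has \<open>p (i - 1)\<close> cliques of size \<open>i - 1\<close>, and the constant
  \<open>(p - 1) / 2 * (2 i - 3) + i - 2\<close> of the hole inequality is \<open>p (i - 1) - (p + 1) / 2\<close>.
  The predicate \<^const>\<open>clique_hole\<close> alone does not force that count.  It also holds for a
  single \<open>K\<^sub>i\<close> (\<open>p = 1\<close>), for three copies of \<open>K\<^sub>i\<close> glued along one common \<open>K\<^sub>i\<^sub>-\<^sub>1\<close>
  (\<open>p = 3\<close>), and for chains whose union contains a further \<open>K\<^sub>i\<^sub>-\<^sub>1\<close> lying in none of the
  copies (the cube of the cycle with 9 vertices, for \<open>i = 4\<close> and \<open>p = 9\<close>).  In these
  examples a \<open>K\<^sub>i\<close>-free set violates the inequality; hence the additional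
  hypothesis \<open>card (cliques (i - 1) H) = p * (i - 1)\<close>.  It holds automatically for
  \<open>i = 3\<close> and \<open>p \<ge> 5\<close>.
\<close>

end

theory Submission
  imports Defs
begin

text \<open>
  Membership in the ideal is tested by evaluation, so everything happens with functions of a
  \<open>K\<^sub>i\<close>-free set \<open>C\<close>, and a 0/1-valued polynomial function is its own square.  Let \<open>c\<^sub>j\<close> be the
  variable of a \<open>K\<^sub>i\<^sub>-\<^sub>1\<close> shared by the \<open>j\<close>-th and the next copy of \<open>K\<^sub>i\<close>, and let \<open>t\<^sub>j\<close> be the sum of
  \<open>1 - x\<close> over the \<open>i - 2\<close> remaining \<open>K\<^sub>i\<^sub>-\<^sub>1\<close>'s of the copy that carries \<open>c\<^sub>j\<close> and \<open>c\<^sub>j\<^sub>+\<^sub>1\<close>.  With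
  \<open>p = 2 k + 1\<close>, the left-hand side of the inequality is
  \<open>\<Sum> (t\<^sub>j - c\<^sub>j c\<^sub>j\<^sub>+\<^sub>1) + (k - \<Sum> c\<^sub>j + \<Sum> c\<^sub>j c\<^sub>j\<^sub>+\<^sub>1)\<close>.  The second bracket is the odd cycle inequality of
  the cut polytope, a sum of triangle inequalities, which are squares of quadratic polynomials.
  Each \<open>t\<^sub>j - c\<^sub>j c\<^sub>j\<^sub>+\<^sub>1\<close> is nonnegative because \<open>C\<close> misses some \<open>K\<^sub>i\<^sub>-\<^sub>1\<close> of that copy, and it is a
  sum of 0/1-valued polynomials of degree at most \<open>\<lceil>i / 2\<rceil>\<close> obtained by splitting the
  \<open>i - 2\<close> cliques into halves.
\<close>

section \<open>Evaluation and degree of polynomials\<close>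

definition monom_eval :: "('v \<Rightarrow> real) \<Rightarrow> ('v \<Rightarrow>\<^sub>0 nat) \<Rightarrow> real" where
  "monom_eval a m = (\<Prod>v \<in> Poly_Mapping.keys m. a v ^ Poly_Mapping.lookup m v)"

definition monom_degree :: "('v \<Rightarrow>\<^sub>0 nat) \<Rightarrow> nat" where
  "monom_degree m = (\<Sum>v \<in> Poly_Mapping.keys m. Poly_Mapping.lookup m v)"

text \<open>Lets \<open>m\<close>, \<open>n\<close> and \<open>m + n\<close> be evaluated over one
  index set: variables of exponent 0 contribute the factor 1.\<close>

lemma monom_eval_superset:
  assumes "finite S" "Poly_Mapping.keys m \<subseteq> S"
  shows "monom_eval a m = (\<Prod>v \<in> S. a v ^ Poly_Mapping.lookup m v)"
  unfolding monom_eval_def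
  by (rule prod.mono_neutral_left) (use assms in \<open>auto simp: in_keys_iff\<close>)

lemma monom_degree_superset:
  assumes "finite S" "Poly_Mapping.keys m \<subseteq> S"
  shows "monom_degree m = (\<Sum>v \<in> S. Poly_Mapping.lookup m v)"
  unfolding monom_degree_def
  by (rule sum.mono_neutral_left) (use assms in \<open>auto simp: in_keys_iff\<close>)

lemma monom_eval_add: "monom_eval a (m + n) = monom_eval a m * monom_eval a n"
proof -
  let ?S = "Poly_Mapping.keys m \<union> Poly_Mapping.keys n"
  have "Poly_Mapping.keys (m + n) \<subseteq> ?S" by (rule keys_add)
  then show ?thesis
    by (simp add: monom_eval_superset[of ?S] lookup_add power_add prod.distrib)
qed

lemma monom_degree_add: "monom_degree (m + n) = monom_degree m + monom_degree n"
proof -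
  let ?S = "Poly_Mapping.keys m \<union> Poly_Mapping.keys n"
  have "Poly_Mapping.keys (m + n) \<subseteq> ?S" by (rule keys_add)
  then show ?thesis
    by (simp add: monom_degree_superset[of ?S] lookup_add sum.distrib)
qed

lemma mpoly_eval_superset:
  assumes "finite S" "Poly_Mapping.keys f \<subseteq> S"
  shows "mpoly_eval a f = (\<Sum>m \<in> S. Poly_Mapping.lookup f m * monom_eval a m)"
  unfolding mpoly_eval_def monom_eval_def
  by (rule sum.mono_neutral_left) (use assms in \<open>auto simp: in_keys_iff\<close>)

lemma mpoly_eval_add: "mpoly_eval a (f + g) = mpoly_eval a f + mpoly_eval a g"
proof -
  let ?S = "Poly_Mapping.keys f \<union> Poly_Mapping.keys g"
  have "Poly_Mapping.keys (f + g) \<subseteq> ?S" by (rule keys_add)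
  then show ?thesis
    by (simp add: mpoly_eval_superset[of ?S] lookup_add distrib_right sum.distrib)
qed

lemma mpoly_eval_zero: "mpoly_eval a 0 = 0"
  by (simp add: mpoly_eval_def)

lemma mpoly_eval_single: "mpoly_eval a (Poly_Mapping.single m c) = c * monom_eval a m"
  by (simp add: mpoly_eval_def monom_eval_def)

lemma mpoly_eval_sum: "mpoly_eval a (sum f S) = (\<Sum>s\<in>S. mpoly_eval a (f s))"
  by (induction S rule: infinite_finite_induct) (simp_all add: mpoly_eval_zero mpoly_eval_add)

lemma mpoly_eval_sum_list: "mpoly_eval a (sum_list fs) = (\<Sum>f\<leftarrow>fs. mpoly_eval a f)"
  by (induction fs) (simp_all add: mpoly_eval_zero mpoly_eval_add)

lemma mpoly_expand:
  fixes f :: "'v mpoly"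
  shows "f = (\<Sum>m \<in> Poly_Mapping.keys f. Poly_Mapping.single m (Poly_Mapping.lookup f m))"
  by (rule poly_mapping_eqI)
    (simp add: lookup_sum lookup_single when_def sum.delta' in_keys_iff)

lemma mpoly_eval_mult: "mpoly_eval a (f * g) = mpoly_eval a f * mpoly_eval a g"
proof -
  have "f * g = (\<Sum>m \<in> Poly_Mapping.keys f. \<Sum>n \<in> Poly_Mapping.keys g.
      Poly_Mapping.single (m + n) (Poly_Mapping.lookup f m * Poly_Mapping.lookup g n))"
    by (subst mpoly_expand[of f], subst mpoly_expand[of g]) (simp add: sum_product mult_single)
  then have "mpoly_eval a (f * g) = (\<Sum>m \<in> Poly_Mapping.keys f. \<Sum>n \<in> Poly_Mapping.keys g.
      (Poly_Mapping.lookup f m * monom_eval a m) * (Poly_Mapping.lookup g n * monom_eval a n))"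
    by (simp add: mpoly_eval_sum mpoly_eval_single monom_eval_add mult_ac)
  then show ?thesis
    by (simp add: mpoly_eval_superset[of "Poly_Mapping.keys f" f] 
        mpoly_eval_superset[of "Poly_Mapping.keys g" g] sum_product)
qed

lemma mpoly_eval_diff: "mpoly_eval a (f - g) = mpoly_eval a f - mpoly_eval a g"
  using mpoly_eval_add[of a "f - g" g] by simp

lemma mpoly_eval_const: "mpoly_eval a (mpoly_const c) = c"
  by (simp add: mpoly_const_def mpoly_eval_single monom_eval_def)

lemma mpoly_eval_var: "mpoly_eval a (mpoly_var v) = a v"
  by (simp add: mpoly_var_def mpoly_eval_single monom_eval_def)

lemma total_degree_le_iff:
  "total_degree f \<le> k \<longleftrightarrow> (\<forall>m \<in> Poly_Mapping.keys f. monom_degree m \<le> k)"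
  by (auto simp: total_degree_def monom_degree_def)

lemma total_degree_add:
  assumes "total_degree f \<le> k" "total_degree g \<le> k"
  shows "total_degree (f + g) \<le> k"
  using assms keys_add[of f g] by (auto simp: total_degree_le_iff)

lemma total_degree_mult:
  assumes "total_degree f \<le> k" "total_degree g \<le> l"
  shows "total_degree (f * g) \<le> k + l"
  unfolding total_degree_le_iff
proof
  fix m assume "m \<in> Poly_Mapping.keys (f * g)"
  then obtain a b where "m = a + b" "a \<in> Poly_Mapping.keys f" "b \<in> Poly_Mapping.keys g"
    using keys_mult[of f g] by blast
  with assms show "monom_degree m \<le> k + l"
    by (auto simp: total_degree_le_iff monom_degree_add intro: add_mono)
qed

lemma mpoly_ring_add: "f \<in> mpoly_ring X \<Longrightarrow> g \<in> mpoly_ring X \<Longrightarrow> f + g \<in> mpoly_ring X"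
  using keys_add[of f g] by (auto simp: mpoly_ring_def)

lemma mpoly_ring_diff: "f \<in> mpoly_ring X \<Longrightarrow> g \<in> mpoly_ring X \<Longrightarrow> f - g \<in> mpoly_ring X"
  using keys_diff[of f g] by (auto simp: mpoly_ring_def)

lemma mpoly_ring_zero: "0 \<in> mpoly_ring X"
  by (simp add: mpoly_ring_def)

lemma mpoly_ring_mult:
  assumes "f \<in> mpoly_ring X" "g \<in> mpoly_ring X"
  shows "f * g \<in> mpoly_ring X"
  unfolding mpoly_ring_def
proof (intro CollectI ballI)
  fix m assume "m \<in> Poly_Mapping.keys (f * g)"
  then obtain a b where "m = a + b" "a \<in> Poly_Mapping.keys f" "b \<in> Poly_Mapping.keys g"
    using keys_mult[of f g] by blast
  with assms show "Poly_Mapping.keys m \<subseteq> X"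
    using keys_add[of a b] by (simp add: mpoly_ring_def) blast
qed

lemma mpoly_ring_sum: "(\<And>s. s \<in> S \<Longrightarrow> f s \<in> mpoly_ring X) \<Longrightarrow> sum f S \<in> mpoly_ring X"
  by (induction S rule: infinite_finite_induct) (auto intro: mpoly_ring_zero mpoly_ring_add)

lemma mpoly_ring_sum_list: "set fs \<subseteq> mpoly_ring X \<Longrightarrow> sum_list fs \<in> mpoly_ring X"
  by (induction fs) (auto intro: mpoly_ring_zero mpoly_ring_add)

lemma mpoly_ring_const: "mpoly_const c \<in> mpoly_ring X"
  by (simp add: mpoly_ring_def mpoly_const_def)

lemma mpoly_ring_var: "v \<in> X \<Longrightarrow> mpoly_var v \<in> mpoly_ring X"
  by (simp add: mpoly_ring_def mpoly_var_def)

lemma total_degree_const: "total_degree (mpoly_const c) = 0"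
  by (simp add: total_degree_def mpoly_const_def)

lemma total_degree_var: "total_degree (mpoly_var v) \<le> 1"
  by (simp add: total_degree_def mpoly_var_def)

section \<open>Sums of squares as functions on a family of sets\<close>

text \<open>The function stands for a residue class modulo the polynomials vanishing at the
  characteristic vectors of members of \<open>F\<close>; only one representative has to meet the
  degree bound.\<close>

definition poly_fun :: "nat \<Rightarrow> 'v set \<Rightarrow> 'v set set \<Rightarrow> ('v set \<Rightarrow> real) \<Rightarrow> bool" where
  "poly_fun k X F \<phi> \<longleftrightarrow> (\<exists>g \<in> mpoly_ring X. total_degree g \<le> k \<and>
      (\<forall>C \<in> F. mpoly_eval (char_vec C) g = \<phi> C))"

definition sos_fun :: "nat \<Rightarrow> 'v set \<Rightarrow> 'v set set \<Rightarrow> ('v set \<Rightarrow> real) \<Rightarrow> bool" where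
  "sos_fun k X F \<phi> \<longleftrightarrow> (\<exists>gs. set gs \<subseteq> mpoly_ring X \<and> (\<forall>g \<in> set gs. total_degree g \<le> k) \<and>
      (\<forall>C \<in> F. (\<Sum>g\<leftarrow>gs. (mpoly_eval (char_vec C) g)\<^sup>2) = \<phi> C))"

lemma poly_fun_mono: "poly_fun k X F \<phi> \<Longrightarrow> k \<le> l \<Longrightarrow> poly_fun l X F \<phi>"
  unfolding poly_fun_def using le_trans by blast

lemma poly_fun_const: "poly_fun k X F (\<lambda>C. c)"
  unfolding poly_fun_def
  by (rule bexI[of _ "mpoly_const c"])
    (auto simp: mpoly_ring_const total_degree_const mpoly_eval_const)

lemma poly_fun_var: "v \<in> X \<Longrightarrow> poly_fun 1 X F (\<lambda>C. char_vec C v)"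
  unfolding poly_fun_def
  by (rule bexI[of _ "mpoly_var v"])
    (use total_degree_var in \<open>auto simp: mpoly_ring_var mpoly_eval_var\<close>)

lemma poly_fun_add:
  assumes "poly_fun k X F \<phi>" "poly_fun k X F \<psi>"
  shows "poly_fun k X F (\<lambda>C. \<phi> C + \<psi> C)"
proof -
  obtain f g where fg: "f \<in> mpoly_ring X" "total_degree f \<le> k"
      "\<forall>C \<in> F. mpoly_eval (char_vec C) f = \<phi> C"
      "g \<in> mpoly_ring X" "total_degree g \<le> k"
      "\<forall>C \<in> F. mpoly_eval (char_vec C) g = \<psi> C"
    using assms unfolding poly_fun_def by blast
  show ?thesis unfolding poly_fun_def
    by (rule bexI[of _ "f + g"])
      (use fg in \<open>auto simp: mpoly_eval_add intro: mpoly_ring_add total_degree_add\<close>)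
qed

lemma poly_fun_mult:
  assumes "poly_fun k X F \<phi>" "poly_fun l X F \<psi>"
  shows "poly_fun (k + l) X F (\<lambda>C. \<phi> C * \<psi> C)"
proof -
  obtain f g where fg: "f \<in> mpoly_ring X" "total_degree f \<le> k"
      "\<forall>C \<in> F. mpoly_eval (char_vec C) f = \<phi> C"
      "g \<in> mpoly_ring X" "total_degree g \<le> l"
      "\<forall>C \<in> F. mpoly_eval (char_vec C) g = \<psi> C"
    using assms unfolding poly_fun_def by blast
  show ?thesis unfolding poly_fun_def
    by (rule bexI[of _ "f * g"])
      (use fg in \<open>auto simp: mpoly_eval_mult intro: mpoly_ring_mult total_degree_mult\<close>)
qed

lemma poly_fun_diff:
  assumes "poly_fun k X F \<phi>" "poly_fun k X F \<psi>"
  shows "poly_fun k X F (\<lambda>C. \<phi> C - \<psi> C)"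
proof -
  have "poly_fun (0 + k) X F (\<lambda>C. - 1 * \<psi> C)"
    by (intro poly_fun_mult poly_fun_const assms(2))
  then show ?thesis
    using poly_fun_add[OF assms(1), of "\<lambda>C. - \<psi> C"] by simp
qed

lemma poly_fun_prod:
  assumes "finite S" "S \<subseteq> X"
  shows "poly_fun (card S) X F (\<lambda>C. \<Prod>v\<in>S. char_vec C v)"
  using assms
proof (induction S)
  case empty
  then show ?case by (simp add: poly_fun_const)
next
  case (insert v S)
  then show ?case
    using poly_fun_mult[OF poly_fun_var[of v X F], of "card S"] by simp
qed

lemma sos_fun_zero: "sos_fun k X F (\<lambda>C. 0)"
  unfolding sos_fun_def by (rule exI[of _ "[]"]) simp

lemma sos_fun_add:
  assumes "sos_fun k X F \<phi>" "sos_fun k X F \<psi>"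
  shows "sos_fun k X F (\<lambda>C. \<phi> C + \<psi> C)"
proof -
  obtain fs gs where fg: "set fs \<subseteq> mpoly_ring X" "\<forall>g \<in> set fs. total_degree g \<le> k"
      "\<forall>C \<in> F. (\<Sum>g\<leftarrow>fs. (mpoly_eval (char_vec C) g)\<^sup>2) = \<phi> C"
      "set gs \<subseteq> mpoly_ring X" "\<forall>g \<in> set gs. total_degree g \<le> k"
      "\<forall>C \<in> F. (\<Sum>g\<leftarrow>gs. (mpoly_eval (char_vec C) g)\<^sup>2) = \<psi> C"
    using assms unfolding sos_fun_def by blast
  show ?thesis unfolding sos_fun_def
    by (rule exI[of _ "fs @ gs"]) (use fg in auto)
qed

lemma sos_fun_sum:
  "(\<And>s. s \<in> S \<Longrightarrow> sos_fun k X F (\<phi> s)) \<Longrightarrow> sos_fun k X F (\<lambda>C. \<Sum>s\<in>S. \<phi> s C)"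
  by (induction S rule: infinite_finite_induct) (auto intro: sos_fun_zero sos_fun_add)

lemma sos_fun_cong:
  "sos_fun k X F \<phi> \<Longrightarrow> (\<And>C. C \<in> F \<Longrightarrow> \<phi> C = \<psi> C) \<Longrightarrow> sos_fun k X F \<psi>"
  unfolding sos_fun_def by simp

lemma sos_fun_mono: "sos_fun k X F \<phi> \<Longrightarrow> k \<le> l \<Longrightarrow> sos_fun l X F \<phi>"
  unfolding sos_fun_def using le_trans by blast

text \<open>A 0/1-valued function is its own square.\<close>

lemma sos_fun_boolean:
  assumes "poly_fun k X F \<phi>" "\<And>C. C \<in> F \<Longrightarrow> \<phi> C \<in> {0, 1}"
  shows "sos_fun k X F \<phi>"
proof -
  obtain g where g: "g \<in> mpoly_ring X" "total_degree g \<le> k"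
      "\<forall>C \<in> F. mpoly_eval (char_vec C) g = \<phi> C"
    using assms(1) unfolding poly_fun_def by blast
  have "(\<phi> C)\<^sup>2 = \<phi> C" if "C \<in> F" for C
    using assms(2)[OF that] by auto
  with g show ?thesis unfolding sos_fun_def
    by (intro exI[of _ "[g]"]) simp
qed

text \<open>The ideal is a vanishing ideal, so a certificate only has to lie in the ring and have
  the right values on clique-free sets.\<close>

lemma sos_mod_clique_free_ideal:
  assumes f: "f \<in> mpoly_ring (cliques (i - 1) G)"
    and "sos_fun k (cliques (i - 1) G) {C. clique_free i G C} (\<lambda>C. mpoly_eval (char_vec C) f)"
  shows "sos_mod k (cliques (i - 1) G) (clique_free_ideal i G) f"
proof -
  let ?X = "cliques (i - 1) G"
  obtain gs where gs: "set gs \<subseteq> mpoly_ring ?X" "\<forall>g \<in> set gs. total_degree g \<le> k"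
      "\<And>C. clique_free i G C \<Longrightarrow>
        (\<Sum>g\<leftarrow>gs. (mpoly_eval (char_vec C) g)\<^sup>2) = mpoly_eval (char_vec C) f"
    using assms(2) unfolding sos_fun_def by auto
  have "f - (\<Sum>g\<leftarrow>gs. g\<^sup>2) \<in> mpoly_ring ?X"
    using gs(1) f by (intro mpoly_ring_diff mpoly_ring_sum_list)
      (auto simp: power2_eq_square intro: mpoly_ring_mult)
  moreover have "mpoly_eval (char_vec C) (f - (\<Sum>g\<leftarrow>gs. g\<^sup>2)) = 0" if "clique_free i G C" for C
    using gs(3)[OF that]
    by (simp add: mpoly_eval_diff mpoly_eval_sum_list o_def power2_eq_square mpoly_eval_mult)
  ultimately show ?thesis
    using gs(1,2) unfolding sos_mod_def clique_free_ideal_def by blast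
qed

section \<open>The two building blocks of the certificate\<close>

lemma prod_char_vec: "finite S \<Longrightarrow> (\<Prod>v\<in>S. char_vec C v) = of_bool (S \<subseteq> C)"
  by (induction S rule: finite_induct) (auto simp: char_vec_def)

text \<open>Induction: with \<open>P\<close> the product over \<open>S\<close>, a new
  \<open>v\<close> adds \<open>(1 - x_v) * (1 - P)\<close>, a 0/1-valued term of degree at most
  \<open>card S + 1\<close>. The subtracted term is the indicator that \<open>C\<close> misses some
  element of \<open>S\<close>.\<close>

lemma sos_fun_sum_minus_or:
  assumes "finite S" "S \<subseteq> X"
  shows "sos_fun (card S) X F (\<lambda>C. (\<Sum>v\<in>S. 1 - char_vec C v) - (1 - (\<Prod>v\<in>S. char_vec C v)))"
  using assms
proof (induction S)
  case empty
  then show ?case by (simp add: sos_fun_zero)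
next
  case (insert v S)
  have "poly_fun (1 + card S) X F (\<lambda>C. (1 - char_vec C v) * (1 - (\<Prod>v\<in>S. char_vec C v)))"
    using insert.prems insert.hyps(1)
    by (intro poly_fun_mult poly_fun_diff poly_fun_const poly_fun_var poly_fun_prod) auto
  then have 1: "sos_fun (card (insert v S)) X F
      (\<lambda>C. (1 - char_vec C v) * (1 - (\<Prod>v\<in>S. char_vec C v)))"
    using insert.hyps by (intro sos_fun_boolean) (auto simp: prod_char_vec char_vec_def)
  have 2: "sos_fun (card (insert v S)) X F
      (\<lambda>C. (\<Sum>v\<in>S. 1 - char_vec C v) - (1 - (\<Prod>v\<in>S. char_vec C v)))"
    using insert by (intro sos_fun_mono[OF insert.IH]) auto
  show ?case
    by (rule sos_fun_cong[OF sos_fun_add[OF 1 2]]) (use insert.hyps in \<open>simp add: algebra_simps\<close>)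
qed

text \<open>Splitting \<open>S\<close> into halves keeps the degree low: with \<open>q\<close> and \<open>r\<close> the indicators that
  a half contains an element outside \<open>C\<close>, and \<open>c\<close>, \<open>d\<close> the values at \<open>a\<close>, \<open>b\<close>, one has
  \<open>q + r - c d = q (1 - d) + r (1 - c) + (q d + r c - c d)\<close>, three 0/1-valued terms because
  \<open>q = r = 0\<close> forces \<open>c d = 0\<close>.\<close>

lemma sos_fun_block:
  assumes S: "finite S" "S \<subseteq> X" "card S \<le> 2 * h" and h: "1 \<le> h"
    and ab: "a \<in> X" "b \<in> X"
    and F: "\<And>C. C \<in> F \<Longrightarrow> \<not> insert a (insert b S) \<subseteq> C"
  shows "sos_fun (h + 1) X F
    (\<lambda>C. (\<Sum>v\<in>S. 1 - char_vec C v) - char_vec C a * char_vec C b)"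
proof -
  obtain S1 where S1: "S1 \<subseteq> S" "card S1 = card S div 2"
    using obtain_subset_with_card_n[of "card S div 2" S] by auto
  define S2 where "S2 = S - S1"
  have fin: "finite S1" "finite S2" and sub: "S1 \<subseteq> X" "S2 \<subseteq> X" and Un: "S = S1 \<union> S2"
    and dis: "S1 \<inter> S2 = {}"
    using S S1 by (auto simp: S2_def intro: finite_subset)
  \<comment> \<open>\<open>S2\<close> is the larger half when \<open>card S\<close> is odd; then
    \<open>card S \<le> 2 * h - 1\<close>, so it still has at most \<open>h\<close>
    elements.\<close>
  have c: "card S1 \<le> h" "card S2 \<le> h"
    using S S1 by (auto simp: S2_def card_Diff_subset finite_subset)
  let ?x = "\<lambda>v C. char_vec C v :: real"
  let ?q = "\<lambda>T C. 1 - (\<Prod>v\<in>T. char_vec C v :: real)"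
  have q: "poly_fun h X F (?q S1)" "poly_fun h X F (?q S2)"
    using fin sub c by (auto intro!: poly_fun_diff poly_fun_const poly_fun_mono[OF poly_fun_prod])
  have qb: "?q T C = of_bool (\<not> T \<subseteq> C)" if "finite T" for T C :: "'a set"
    using that by (simp add: prod_char_vec)
  have "sos_fun (h + 1) X F (\<lambda>C. ?q T C * (1 - ?x v C))"
    if "poly_fun h X F (?q T)" "finite T" "v \<in> X" for T v
    by (rule sos_fun_boolean)
      (intro poly_fun_mult poly_fun_diff[OF poly_fun_const poly_fun_var] that,
        use that in \<open>auto simp: qb char_vec_def\<close>)
  note s1 = this[OF q(1) fin(1) ab(2)] this[OF q(2) fin(2) ab(1)]
  \<comment> \<open>This product has degree 2; \<open>1 \<le> h\<close> makes it fit under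
    \<open>h + 1\<close>.\<close>
  have "poly_fun (1 + 1) X F (\<lambda>C. ?x a C * ?x b C)"
    using ab by (intro poly_fun_mult poly_fun_var)
  then have "poly_fun (h + 1) X F (\<lambda>C. ?x a C * ?x b C)"
    by (rule poly_fun_mono) (use h in simp)
  note pf = poly_fun_diff[OF poly_fun_add[OF poly_fun_mult[OF q(1) poly_fun_var[OF ab(2)]]
        poly_fun_mult[OF q(2) poly_fun_var[OF ab(1)]]] this]
  have s2: "sos_fun (h + 1) X F (\<lambda>C. ?q S1 C * ?x b C + ?q S2 C * ?x a C - ?x a C * ?x b C)"
  proof (rule sos_fun_boolean[OF pf])
    fix C assume "C \<in> F"
    then show "?q S1 C * ?x b C + ?q S2 C * ?x a C - ?x a C * ?x b C \<in> {0, 1}"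
      unfolding qb[OF fin(1)] qb[OF fin(2)] using F by (auto simp: char_vec_def Un)
  qed
  have s3: "sos_fun (h + 1) X F (\<lambda>C. (\<Sum>v\<in>S1. 1 - ?x v C) - ?q S1 C)"
    "sos_fun (h + 1) X F (\<lambda>C. (\<Sum>v\<in>S2. 1 - ?x v C) - ?q S2 C)"
    using fin sub c by (auto intro!: sos_fun_mono[OF sos_fun_sum_minus_or])
  have sumS: "(\<Sum>v\<in>S. f v) = (\<Sum>v\<in>S1. f v) + (\<Sum>v\<in>S2. f v)" for f :: "'a \<Rightarrow> real"
    unfolding Un by (rule sum.union_disjoint[OF fin dis])
  have alg: "q * (1 - d) + r * (1 - c) + (q * d + r * c - c * d + (s - q + (t - r))) = s + t - c * d"
    for q r c d s t :: real
    by (simp add: algebra_simps)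
  show ?thesis
    by (rule sos_fun_cong[OF sos_fun_add[OF sos_fun_add[OF s1] sos_fun_add[OF s2 sos_fun_add[OF s3]]]])
      (unfold sumS, rule alg)
qed

text \<open>Two new vertices \<open>w\<close>, \<open>z\<close> between \<open>v\<close> and \<open>u\<close> on the cycle add
  \<open>1 - w - z + v w + w z + z u - v u = (u - v) (u - w) + (1 - u - w) (1 - u - z)\<close> for 0/1 values;
  both products are 0/1-valued.\<close>

lemma sos_fun_odd_cycle:
  fixes k :: nat
  assumes "\<And>j. j \<le> 2 * k \<Longrightarrow> e j \<in> X"
  shows "sos_fun 2 X F (\<lambda>C. real k - (\<Sum>j<2 * k + 1. char_vec C (e j))
    + (\<Sum>j<2 * k. char_vec C (e j) * char_vec C (e (Suc j)))
    + char_vec C (e (2 * k)) * char_vec C (e 0))"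
  using assms
proof (induction k)
  case 0
  \<comment> \<open>For one vertex the closing product is \<open>c * c = c\<close>, so the
    expression vanishes.\<close>
  show ?case
    by (rule sos_fun_cong[OF sos_fun_zero]) (simp add: char_vec_def)
next
  case (Suc k)
  let ?u = "\<lambda>C. char_vec C (e 0)" and ?v = "\<lambda>C. char_vec C (e (2 * k))"
    and ?w = "\<lambda>C. char_vec C (e (2 * k + 1))" and ?z = "\<lambda>C. char_vec C (e (2 * k + 2))"
  have pf: "poly_fun 1 X F ?u" "poly_fun 1 X F ?v" "poly_fun 1 X F ?w" "poly_fun 1 X F ?z"
    by (intro poly_fun_var Suc.prems; simp)+
  note d = poly_fun_diff[OF poly_fun_diff[OF poly_fun_const[of 1 X F 1] pf(1)]]
  have pp: "poly_fun 2 X F (\<lambda>C. (?u C - ?v C) * (?u C - ?w C))"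
    "poly_fun 2 X F (\<lambda>C. (1 - ?u C - ?w C) * (1 - ?u C - ?z C))"
    using poly_fun_mult[OF poly_fun_diff[OF pf(1,2)] poly_fun_diff[OF pf(1,3)]]
      poly_fun_mult[OF d[OF pf(3)] d[OF pf(4)]]
    unfolding one_add_one .
  \<comment> \<open>For \<open>u = 0\<close> the value is \<open>v * w\<close>, for
    \<open>u = 1\<close> it is \<open>(1 - v) * (1 - w)\<close>.\<close>
  have 1: "sos_fun 2 X F (\<lambda>C. (?u C - ?v C) * (?u C - ?w C))"
    by (rule sos_fun_boolean[OF pp(1)]) (auto simp: char_vec_def)
  have 2: "sos_fun 2 X F (\<lambda>C. (1 - ?u C - ?w C) * (1 - ?u C - ?z C))"
    by (rule sos_fun_boolean[OF pp(2)]) (auto simp: char_vec_def)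
  have 3: "sos_fun 2 X F (\<lambda>C. real k - (\<Sum>j<2 * k + 1. char_vec C (e j))
    + (\<Sum>j<2 * k. char_vec C (e j) * char_vec C (e (Suc j)))
    + char_vec C (e (2 * k)) * char_vec C (e 0))"
    using Suc by simp
  \<comment> \<open>Expansion leaves \<open>2 * u * u - 2 * u\<close>, which cancels by idempotence
    of \<open>u\<close>.\<close>
  have alg: "(u - v) * (u - w) + (1 - u - w) * (1 - u - z) = 1 - w - z + v * w + w * z + z * u - v * u"
    if "u * u = u" for u v w z :: real
    using that by (simp add: ring_distribs)
  have idem: "char_vec C v * char_vec C v = char_vec C v" for C and v :: 'a
    by (simp add: char_vec_def)
  show ?case
    by (rule sos_fun_cong[OF sos_fun_add[OF 3 sos_fun_add[OF 1 2]]]) (simp add: alg[OF idem])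
qed

section \<open>Cliques and holes\<close>

lemma graph_induced_subgraph:
  assumes "graph G" "induced_subgraph H G"
  shows "graph H"
  using assms digraph.digraphI_induced[of G H] sym_digraph.induced_graph_imp_graph[of G H]
  unfolding graph_def pseudo_graph_def digraph_def by blast

text \<open>Induced subgraphs of a graph are graphs and have no loops, so completeness reduces to
  pairwise adjacency.\<close>

lemma mem_cliques_iff:
  assumes "graph G"
  shows "S \<in> cliques j G \<longleftrightarrow> S \<subseteq> verts G \<and> card S = j \<and>
    (\<forall>u \<in> S. \<forall>v \<in> S. u \<noteq> v \<longrightarrow> (u, v) \<in> arcs_ends G)"
proof -
  interpret graph G by fact
  have ends: "arcs_ends (G \<restriction> S) = {(u, v) \<in> arcs_ends G. u \<in> S \<and> v \<in> S}"
    by (auto simp: arcs_ends_def arc_to_ends_def)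
  have "u \<noteq> v" if "(u, v) \<in> arcs_ends G" for u v
    using that no_loops by (auto simp: arcs_ends_def arc_to_ends_def)
  moreover have "graph (G \<restriction> S)" if "S \<subseteq> verts G"
    using that by (intro graph_induced_subgraph[OF assms] induced_induce)
  ultimately show ?thesis
    by (fastforce simp: cliques_def complete_digraph_def ends)
qed

lemma cliques_subgraph_mono:
  assumes "graph G" "graph H" "subgraph H G"
  shows "cliques j H \<subseteq> cliques j G"
  using assms arcs_ends_mono[OF assms(3)] by (fastforce simp: mem_cliques_iff subgraph_def)

lemma cliques_complete_digraph:
  assumes "complete_digraph n Q"
  shows "cliques j Q = {S. S \<subseteq> verts Q \<and> card S = j}"
proof -
  have "graph Q" "arcs_ends Q = {(u,v). (u,v) \<in> verts Q \<times> verts Q \<and> u \<noteq> v}"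
    using assms by (auto simp: complete_digraph_def)
  then show ?thesis by (auto simp: mem_cliques_iff)
qed

section \<open>Sets of size \<open>n - 1\<close> inside sets of size \<open>n\<close>\<close>

lemma card_subsets_pred:
  assumes "card A = n" "1 \<le> n"
  shows "card {S. S \<subseteq> A \<and> card S = n - 1} = n"
proof -
  have "finite A" using assms by (intro card_ge_0_finite) simp
  then show ?thesis
    using assms n_subsets[of A "n - 1"] binomial_symmetric[of 1 n] by simp
qed

text \<open>Distinct \<open>n\<close>-sets meet in at most \<open>n - 1\<close> elements, so a
  common subset of that size is the whole intersection.\<close>

lemma common_pred_subset_unique:
  assumes "card A = n" "card B = n" "1 \<le> n" "A \<noteq> B"
    and "S \<subseteq> A" "S \<subseteq> B" "card S = n - 1" "T \<subseteq> A" "T \<subseteq> B" "card T = n - 1"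
  shows "S = T"
proof -
  have fin: "finite A" "finite B" using assms by (auto intro: card_ge_0_finite)
  have "A \<inter> B \<noteq> A" using assms fin by (metis card_subset_eq inf.absorb_iff1)
  then have "card (A \<inter> B) < n" using fin assms(1) by (metis inf_le1 psubsetI psubset_card_mono)
  then have "card (A \<inter> B) \<le> n - 1" by simp
  then have "S = A \<inter> B" "T = A \<inter> B"
    using fin assms by (intro card_seteq; simp)+
  then show ?thesis by simp
qed

text \<open>Passes from the indices 1 to \<open>p\<close> of a hole to 0 to \<open>p - 1\<close>.
  The congruence to -1 is the congruence to 1 with \<open>j\<close> and \<open>l\<close>
  exchanged.\<close>

lemma cong_adjacent_iff:
  assumes "j < p" "l < p" "j \<noteq> l"
  shows "[int (Suc j) - int (Suc l) = 1] (mod int p) \<or> [int (Suc j) - int (Suc l) = - 1] (mod int p)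
    \<longleftrightarrow> j = Suc l mod p \<or> l = Suc j mod p"
proof -
  have aux: "[int (Suc j) - int (Suc l) = 1] (mod int p) \<longleftrightarrow> j = Suc l mod p"
    if "j < p" "l < p" "j \<noteq> l" for j l
  proof -
    have "[int (Suc j) - int (Suc l) = 1] (mod int p) \<longleftrightarrow> [int j = int (Suc l)] (mod int p)"
      by (simp add: cong_iff_dvd_diff algebra_simps)
    also have "\<dots> \<longleftrightarrow> j mod p = Suc l mod p"
      by (simp only: cong_int_iff) (simp add: cong_def)
    finally show ?thesis using that by simp
  qed
  have "[int (Suc j) - int (Suc l) = - 1] (mod int p) \<longleftrightarrow> [int (Suc l) - int (Suc j) = 1] (mod int p)"
    using cong_minus_minus_iff[of "int (Suc j) - int (Suc l)" "- 1" "int p"] by simp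
  then show ?thesis using aux[of j l] aux[of l j] assms by auto
qed

section \<open>The certificate for a cyclic family of sets\<close>

lemma Suc_mod_cases: "j < p \<Longrightarrow> Suc j mod p = (if Suc j = p then 0 else Suc j)"
  by (simp add: mod_Suc)

text \<open>Abstract form of the inequality: \<open>N j\<close> models the cliques of size
  \<open>i - 1\<close> in the \<open>j\<close>-th copy, \<open>Y\<close> those of the hole. The
  target counts the members of \<open>Y\<close> missing from \<open>C\<close>, less
  \<open>k + 1\<close>.\<close>

lemma sos_fun_cyclic_cover:
  fixes N :: "nat \<Rightarrow> 'v set" and e :: "nat \<Rightarrow> 'v" and h k p :: nat
  assumes p: "p = 2 * k + 1" and k: "1 \<le> k" and h: "1 \<le> h"
    and N: "\<And>j. j < p \<Longrightarrow> finite (N j) \<and> card (N j) \<le> 2 * h + 2"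
    and e: "\<And>j. j < p \<Longrightarrow> e j \<in> N j \<inter> N (Suc j mod p)"
    and uniq: "\<And>j l L M. \<lbrakk>j < p; l < p; j \<noteq> l; L \<in> N j \<inter> N l; M \<in> N j \<inter> N l\<rbrakk> \<Longrightarrow> L = M"
    and triple: "\<And>j l m. \<lbrakk>j < p; l < p; m < p; j \<noteq> l; j \<noteq> m; l \<noteq> m\<rbrakk> \<Longrightarrow> N j \<inter> N l \<inter> N m = {}"
    and adj: "\<And>j l. \<lbrakk>j < p; l < p; j \<noteq> l; N j \<inter> N l \<noteq> {}\<rbrakk>
      \<Longrightarrow> j = Suc l mod p \<or> l = Suc j mod p"
    and Y: "finite Y" "Y \<subseteq> X" "\<And>j. j < p \<Longrightarrow> N j \<subseteq> Y"
    and F: "\<And>C j. C \<in> F \<Longrightarrow> j < p \<Longrightarrow> \<not> N j \<subseteq> C"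
  shows "sos_fun (h + 1) X F (\<lambda>C. (\<Sum>K\<in>Y. 1 - char_vec C K) - real (k + 1))"
proof -
  define s where "s = (\<lambda>j. Suc j mod p)"
  have s_lt: "s j < p" if "j < p" for j
    using that by (simp add: s_def)
  have s: "s j = (if Suc j = p then 0 else Suc j)" if "j < p" for j
    using that by (simp add: s_def Suc_mod_cases)
  \<comment> \<open>A cycle of length at least 3 has a successor map without fixed points and
    2-cycles.\<close>
  have s_ne: "s j \<noteq> j" "s (s j) \<noteq> j" if "j < p" for j
    using that s[OF that] s[OF s_lt[OF that]] p k by (auto split: if_splits)
  have s_inj: "j = l" if "s j = s l" "j < p" "l < p" for j l
    using that s[of j] s[of l] by (auto split: if_splits)
  have e1: "e j \<in> N j" "e j \<in> N (s j)" if "j < p" for j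
    using e[OF that] by (auto simp: s_def)
  have eX: "e j \<in> X" if "j < p" for j
    using e1[OF that] Y that by blast
  \<comment> \<open>An element \<open>e j = e l\<close> with \<open>j \<noteq> l\<close> would lie
    in three different sets of the family, against \<open>triple\<close>.\<close>
  have inj_e: "inj_on e {..<p}"
  proof (rule inj_onI, rule ccontr)
    fix j l assume jl: "j \<in> {..<p}" "l \<in> {..<p}" "e j = e l" "j \<noteq> l"
    show False
    proof (cases "l = s j")
      case True
      then show False
        using triple[of j "s j" "s l"] jl e1[of j] e1[of l] s_ne[of j] s_ne[of l] s_lt[of j] s_lt[of l]
        by auto
    next
      case False
      then show False
        using triple[of j "s j" l] jl e1[of j] e1[of l] s_ne[of j] s_lt[of j] by auto
    qed
  qed
  \<comment> \<open>The index is shifted: \<open>e j\<close> and \<open>e (s j)\<close> both lie in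
    \<open>N (s j)\<close>, and \<open>R j\<close> is the rest of that set.\<close>
  define R where "R j = N (s j) - {e j, e (s j)}" for j
  have finR: "finite (R j)" if "j < p" for j
    using N[OF s_lt[OF that]] by (simp add: R_def)
  have cardR: "card (R j) \<le> 2 * h" if "j < p" for j
  proof -
    have "e j \<noteq> e (s j)"
      using inj_onD[OF inj_e, of j "s j"] s_ne[OF that] s_lt[OF that] that by auto
    moreover have "{e j, e (s j)} \<subseteq> N (s j)"
      using e1 that s_lt by auto
    ultimately show ?thesis
      using N[OF s_lt[OF that]] by (simp add: R_def card_Diff_subset le_diff_conv)
  qed
  have adj_s: "N j \<inter> N l \<noteq> {} \<Longrightarrow> j < p \<Longrightarrow> l < p \<Longrightarrow> j \<noteq> l \<Longrightarrow> j = s l \<or> l = s j" for j l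
    using adj unfolding s_def by blast
  \<comment> \<open>Consecutive sets share only \<open>e (s j)\<close>, which \<open>R j\<close> and
    \<open>R (s j)\<close> both leave out.\<close>
  have disR1: "R j \<inter> R (s j) = {}" if "j < p" for j
  proof (rule ccontr)
    assume "R j \<inter> R (s j) \<noteq> {}"
    then obtain L where L: "L \<in> N (s j) \<inter> N (s (s j))" "L \<noteq> e (s j)"
      by (auto simp: R_def)
    have "e (s j) \<in> N (s j) \<inter> N (s (s j))"
      using e1[OF s_lt[OF that]] by blast
    then show False
      using uniq[OF s_lt[OF that] s_lt[OF s_lt[OF that]] s_ne(1)[OF s_lt[OF that], symmetric] L(1)] L(2)
      by blast
  qed
  have disR: "R j \<inter> R l = {}" if "j < p" "l < p" "j \<noteq> l" for j l
  proof (rule ccontr)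
    assume ne: "R j \<inter> R l \<noteq> {}"
    then have "N (s j) \<inter> N (s l) \<noteq> {}" by (auto simp: R_def)
    then have "s j = s (s l) \<or> s l = s (s j)"
      using adj_s[of "s j" "s l"] that s_lt s_inj by blast
    then have "j = s l \<or> l = s j"
      using s_inj s_lt that by blast
    then show False
      using disR1[of j] disR1[of l] ne that by auto
  qed
  \<comment> \<open>Otherwise \<open>e l\<close> would lie in \<open>N l\<close>,
    \<open>N (s l)\<close> and \<open>N (s j)\<close>, three different sets.\<close>
  have disRe: "e l \<notin> R j" if "j < p" "l < p" for j l
  proof
    assume "e l \<in> R j"
    then have "e l \<in> N (s j)" "l \<noteq> j" "l \<noteq> s j" by (auto simp: R_def)
    then show False
      using triple[of l "s l" "s j"] e1[of l] s_ne[of l] s_lt[of l] s_lt[of j] s_inj[of l j] that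
      by auto
  qed
  \<comment> \<open>\<open>W\<close> is the union of all \<open>N j\<close>, split disjointly;
    members of \<open>Y - W\<close> enter the certificate through their own 0/1-valued
    terms.\<close>
  define W where "W = e ` {..<p} \<union> (\<Union>j<p. R j)"
  have WY: "W \<subseteq> Y"
    using e1 Y(3) s_lt by (fastforce simp: W_def R_def)
  have sumW: "(\<Sum>K\<in>W. f K) = (\<Sum>j<p. f (e j)) + (\<Sum>j<p. \<Sum>K\<in>R j. f K)" for f :: "'v \<Rightarrow> real"
  proof -
    have "(\<Sum>K\<in>W. f K) = (\<Sum>K\<in>e ` {..<p}. f K) + (\<Sum>K\<in>(\<Union>j<p. R j). f K)"
      unfolding W_def using finR disRe by (intro sum.union_disjoint) auto
    also have "(\<Sum>K\<in>(\<Union>j<p. R j). f K) = (\<Sum>j<p. \<Sum>K\<in>R j. f K)"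
      using finR disR by (intro sum.UNION_disjoint) auto
    finally show ?thesis
      by (simp add: sum.reindex[OF inj_e])
  qed
  have 1: "sos_fun (h + 1) X F (\<lambda>C. \<Sum>K\<in>Y - W. 1 - char_vec C K)"
  proof (rule sos_fun_sum)
    fix K assume "K \<in> Y - W"
    then have "poly_fun 1 X F (\<lambda>C. 1 - char_vec C K)"
      using Y by (intro poly_fun_diff poly_fun_const poly_fun_var) auto
    then have "poly_fun (h + 1) X F (\<lambda>C. 1 - char_vec C K)"
      by (rule poly_fun_mono) simp
    then show "sos_fun (h + 1) X F (\<lambda>C. 1 - char_vec C K)"
      by (rule sos_fun_boolean) (simp add: char_vec_def)
  qed
  have 2: "sos_fun (h + 1) X F
      (\<lambda>C. \<Sum>j<p. (\<Sum>K\<in>R j. 1 - char_vec C K) - char_vec C (e j) * char_vec C (e (s j)))"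
  proof (rule sos_fun_sum)
    fix j assume "j \<in> {..<p}"
    then have j: "j < p" by simp
    have "insert (e j) (insert (e (s j)) (R j)) = N (s j)"
      using e1 j s_lt by (auto simp: R_def)
    then show "sos_fun (h + 1) X F
      (\<lambda>C. (\<Sum>K\<in>R j. 1 - char_vec C K) - char_vec C (e j) * char_vec C (e (s j)))"
      using F[of _ "s j"] finR[OF j] cardR[OF j] h eX j s_lt[OF j] Y(2) Y(3)[of "s j"]
      by (intro sos_fun_block) (auto simp: R_def)
  qed
  have "sos_fun 2 X F (\<lambda>C. real k - (\<Sum>j<2 * k + 1. char_vec C (e j))
    + (\<Sum>j<2 * k. char_vec C (e j) * char_vec C (e (Suc j)))
    + char_vec C (e (2 * k)) * char_vec C (e 0))"
    by (rule sos_fun_odd_cycle) (use eX p in auto)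
  then have 3: "sos_fun (h + 1) X F (\<lambda>C. real k - (\<Sum>j<2 * k + 1. char_vec C (e j))
    + (\<Sum>j<2 * k. char_vec C (e j) * char_vec C (e (Suc j)))
    + char_vec C (e (2 * k)) * char_vec C (e 0))"
    by (rule sos_fun_mono) (use h in simp)
  have wrap: "(\<Sum>j<p. char_vec C (e j) * char_vec C (e (s j)))
    = (\<Sum>j<2 * k. char_vec C (e j) * char_vec C (e (Suc j)))
      + char_vec C (e (2 * k)) * char_vec C (e 0)" for C :: "'v set"
    using s p by simp
  show ?thesis
  proof (rule sos_fun_cong[OF sos_fun_add[OF 1 sos_fun_add[OF 2 3]]])
    fix C
    have "(\<Sum>K\<in>Y. 1 - char_vec C K) = (\<Sum>K\<in>Y - W. 1 - char_vec C K) + (\<Sum>K\<in>W. 1 - char_vec C K)"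
      using WY Y(1) by (rule sum.subset_diff)
    \<comment> \<open>The products cancel, and \<open>p = 2 * k + 1\<close> turns
      \<open>k - \<Sum> c\<close> into \<open>\<Sum> (1 - c) - (k + 1)\<close>.\<close>
    then show "(\<Sum>K\<in>Y - W. 1 - char_vec C K) +
        ((\<Sum>j<p. (\<Sum>K\<in>R j. 1 - char_vec C K) - char_vec C (e j) * char_vec C (e (s j))) +
         (real k - (\<Sum>j<2 * k + 1. char_vec C (e j))
           + (\<Sum>j<2 * k. char_vec C (e j) * char_vec C (e (Suc j)))
           + char_vec C (e (2 * k)) * char_vec C (e 0)))
      = (\<Sum>K\<in>Y. 1 - char_vec C K) - real (k + 1)"
      unfolding sumW sum_subtractf[of _ _ "{..<p}"] wrap using p by (simp add: algebra_simps)
  qed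
qed

section \<open>Excluding degenerate holes\<close>

lemma subset_either_if_pairs_subset:
  assumes "\<And>u v. u \<in> S \<Longrightarrow> v \<in> S \<Longrightarrow> u \<noteq> v \<Longrightarrow> {u, v} \<subseteq> A \<or> {u, v} \<subseteq> B"
    and "S \<subseteq> A \<union> B"
  shows "S \<subseteq> A \<or> S \<subseteq> B"
proof (rule ccontr)
  assume "\<not> (S \<subseteq> A \<or> S \<subseteq> B)"
  then obtain u v where "u \<in> S" "u \<notin> A" "v \<in> S" "v \<notin> B" by blast
  then show False using assms(1)[of u v] assms(2) by auto
qed

text \<open>The count of \<open>(i - 1)\<close>-cliques rules out \<open>p = 1\<close> and the degenerate holes with \<open>p = 3\<close>;
  for \<open>p \<ge> 5\<close> a cycle of length \<open>p\<close> has no triangle.\<close>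

lemma hole_nondegenerate:
  fixes A :: "nat \<Rightarrow> 'a set" and i p :: nat
  defines "N \<equiv> \<lambda>j. {S. S \<subseteq> A j \<and> card S = i - 1}"
  assumes i: "3 \<le> i" and p: "odd p"
    and A: "\<And>j. j < p \<Longrightarrow> card (A j) = i"
    and adj: "\<And>j l. j < p \<Longrightarrow> l < p \<Longrightarrow> j \<noteq> l \<Longrightarrow>
      N j \<inter> N l \<noteq> {} \<longleftrightarrow> j = Suc l mod p \<or> l = Suc j mod p"
    and Y: "card Y = p * (i - 1)" "\<And>j. j < p \<Longrightarrow> N j \<subseteq> Y"
    and pairs: "\<And>S u v. S \<in> Y \<Longrightarrow> u \<in> S \<Longrightarrow> v \<in> S \<Longrightarrow> u \<noteq> v \<Longrightarrow> \<exists>j<p. {u, v} \<subseteq> A j"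
    and Y_sub: "\<And>S. S \<in> Y \<Longrightarrow> S \<subseteq> (\<Union>j<p. A j) \<and> card S = i - 1"
  shows "3 \<le> p"
    and "\<And>j l. j < p \<Longrightarrow> l < p \<Longrightarrow> j \<noteq> l \<Longrightarrow> A j \<noteq> A l"
    and "\<And>j l m. j < p \<Longrightarrow> l < p \<Longrightarrow> m < p \<Longrightarrow> j \<noteq> l \<Longrightarrow> j \<noteq> m \<Longrightarrow> l \<noteq> m \<Longrightarrow> N j \<inter> N l \<inter> N m = {}"
proof -
  have cardN: "card (N j) = i" if "j < p" for j
    unfolding N_def using card_subsets_pred[OF A[OF that]] i by simp
  then have finN: "finite (N j)" if "j < p" for j
    using that i by (intro card_ge_0_finite) simp
  have "p > 0" using p by (rule odd_pos)
  then have finY: "finite Y" using Y(1) i by (intro card_ge_0_finite) simp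
  \<comment> \<open>A single copy would leave \<open>Y\<close> with only \<open>i - 1\<close>
    elements, fewer than \<open>N 0\<close> has.\<close>
  have "p \<noteq> 1"
  proof
    assume "p = 1"
    then have "i \<le> i - 1" using card_mono[OF finY Y(2)[of 0]] cardN[of 0] Y(1) by simp
    then show False using i by simp
  qed
  then show p3: "3 \<le> p" using p \<open>p > 0\<close> by (cases "p = 2") auto
  \<comment> \<open>For \<open>p \<ge> 5\<close> the index after \<open>l\<close> is adjacent to
    \<open>l\<close> but not to \<open>j\<close>, which tells \<open>N l\<close> from
    \<open>N j\<close>.\<close>
  have nbr: "\<exists>m<p. m \<noteq> j \<and> m \<noteq> l \<and> N l \<inter> N m \<noteq> {} \<and> \<not> (j = Suc m mod p \<or> m = Suc j mod p)"
    if "p \<noteq> 3" "j < p" "l < p" "l = Suc j mod p" for j l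
  proof -
    have "p \<ge> 5" using p3 that(1) p by (cases "p = 4") auto
    let ?m = "Suc l mod p"
    have m: "?m < p" using \<open>p > 0\<close> by simp
    have *: "?m \<noteq> j" "?m \<noteq> l" "\<not> (j = Suc ?m mod p \<or> ?m = Suc j mod p)"
      using that m \<open>p \<ge> 5\<close> by (auto simp: Suc_mod_cases split: if_splits)
    have "N l \<inter> N ?m \<noteq> {}"
      using adj[OF that(3) m *(2)[symmetric]] by simp
    then show ?thesis using m * by blast
  qed
  have dist1: "A j \<noteq> A l" if "p \<noteq> 3" "j < p" "l < p" "l = Suc j mod p" for j l
  proof
    assume "A j = A l"
    then have "N j = N l" by (simp add: N_def)
    then show False using nbr[OF that] adj[of j] that by blast
  qed
  show dist: "A j \<noteq> A l" if jl: "j < p" "l < p" "j \<noteq> l" for j l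
  proof
    assume eq: "A j = A l"
    then have NN: "N j = N l" by (simp add: N_def)
    have "N j \<noteq> {}" using cardN[OF jl(1)] i by auto
    then have "j = Suc l mod p \<or> l = Suc j mod p" using adj[OF jl] NN by auto
    then have "p = 3" using dist1[of j l] dist1[of l j] jl eq by auto
    then obtain m where m: "m < p" "m \<noteq> j" "m \<noteq> l" "{..<p} = {j, l, m}"
    proof -
      have "\<exists>m<3. m \<noteq> j \<and> m \<noteq> l \<and> {..<3} = {j, l, m}"
        using jl \<open>p = 3\<close> by (auto simp: numeral_3_eq_3 less_Suc_eq lessThan_Suc)
      then show ?thesis using that \<open>p = 3\<close> by blast
    qed
    have "j = 0 \<or> j = 1 \<or> j = 2" "m = 0 \<or> m = 1 \<or> m = 2"
      using jl(1) m(1) \<open>p = 3\<close> by auto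
    then have "j = Suc m mod p \<or> m = Suc j mod p"
      using m(2) \<open>p = 3\<close> by auto
    then have "N j \<inter> N m \<noteq> {}"
      using adj[OF jl(1) m(1) m(2)[symmetric]] by blast
    then have "card (N j \<inter> N m) \<ge> 1" using finN[OF jl(1)] by (simp add: Suc_le_eq card_gt_0_iff)
    moreover have "card (N j \<union> N m) + card (N j \<inter> N m) = 2 * i"
      using card_Un_Int[OF finN[OF jl(1)] finN[OF m(1)]] cardN jl m by simp
    \<comment> \<open>As \<open>A l = A j\<close>, every pair in a member of \<open>Y\<close> lies
      in \<open>A j\<close> or in \<open>A m\<close>; hence so does the whole member.\<close>
    moreover have "Y \<subseteq> N j \<union> N m"
    proof
      fix S assume S: "S \<in> Y"
      have "{u, v} \<subseteq> A j \<or> {u, v} \<subseteq> A m" if "u \<in> S" "v \<in> S" "u \<noteq> v" for u v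
      proof -
        obtain n where "n \<in> {..<p}" "{u, v} \<subseteq> A n" using pairs[OF S \<open>u \<in> S\<close> \<open>v \<in> S\<close> \<open>u \<noteq> v\<close>] by auto
        then show ?thesis using eq unfolding m(4) by auto
      qed
      moreover have "S \<subseteq> A j \<union> A m"
        using Y_sub[OF S] eq unfolding m(4) by blast
      ultimately have "S \<subseteq> A j \<or> S \<subseteq> A m"
        by (rule subset_either_if_pairs_subset)
      then show "S \<in> N j \<union> N m" using Y_sub[OF S] by (auto simp: N_def)
    qed
    ultimately have "card Y \<le> 2 * i - 1"
      using card_mono[of "N j \<union> N m" Y] finN jl m by auto
    \<comment> \<open>\<open>3 * (i - 1)\<close> exceeds \<open>2 * i - 1\<close> because
      \<open>i \<ge> 3\<close>.\<close>
    then show False using Y(1) \<open>p = 3\<close> i by simp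
  qed
  show "N j \<inter> N l \<inter> N m = {}"
    if jlm: "j < p" "l < p" "m < p" "j \<noteq> l" "j \<noteq> m" "l \<noteq> m" for j l m
  proof (rule ccontr)
    assume "N j \<inter> N l \<inter> N m \<noteq> {}"
    then obtain L where L: "L \<in> N j" "L \<in> N l" "L \<in> N m" by blast
    have "j = Suc l mod p \<or> l = Suc j mod p" "j = Suc m mod p \<or> m = Suc j mod p"
      "l = Suc m mod p \<or> m = Suc l mod p"
      using adj[of j l] adj[of j m] adj[of l m] jlm L by blast+
    \<comment> \<open>Three pairwise adjacent positions exist only on a cycle of length 3.\<close>
    then have "p = 3"
      using jlm(4-6) unfolding Suc_mod_cases[OF jlm(1)] Suc_mod_cases[OF jlm(2)] Suc_mod_cases[OF jlm(3)]
      by (auto split: if_splits)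
    have int: "N a \<inter> N b = {L}" if "a < p" "b < p" "a \<noteq> b" "L \<in> N a" "L \<in> N b" for a b
    proof -
      have "M = L" if "M \<in> N a \<inter> N b" for M
        using common_pred_subset_unique[OF A[OF \<open>a < p\<close>] A[OF \<open>b < p\<close>] _ dist[OF \<open>a < p\<close> \<open>b < p\<close> \<open>a \<noteq> b\<close>],
            of M L] that \<open>L \<in> N a\<close> \<open>L \<in> N b\<close> i by (auto simp: N_def)
      then show ?thesis using that by blast
    qed
    \<comment> \<open>Three \<open>i\<close>-element families that pairwise share exactly
      \<open>L\<close> have \<open>3 * i - 2\<close> members together, one more than
      \<open>Y\<close>.\<close>
    have "card (N j \<union> N l) + 1 = 2 * i"
      using card_Un_Int[OF finN[OF jlm(1)] finN[OF jlm(2)]] cardN jlm int[of j l] L by simp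
    moreover have "(N j \<union> N l) \<inter> N m = {L}"
      using int[of j m] int[of l m] jlm L by blast
    then have "card (N j \<union> N l \<union> N m) + 1 = card (N j \<union> N l) + i"
      using card_Un_Int[of "N j \<union> N l" "N m"] finN cardN jlm by simp
    moreover have "card (N j \<union> N l \<union> N m) \<le> card Y"
      using jlm Y(2) by (intro card_mono finY) auto
    ultimately show False using Y(1) \<open>p = 3\<close> i by simp
  qed
qed

section \<open>The hole inequality\<close>

theorem lemma3p4:
  fixes G H :: "('a, 'b) pre_digraph" and i p :: nat
  assumes "i \<ge> 3"
    and "odd p"
    and "graph G"
    and "induced_subgraph H G"
    and "clique_hole i p H"
    and "card (cliques (i - 1) H) = p * (i - 1)"
  shows "sos_mod (nat \<lceil>real i / 2\<rceil>) (cliques (i - 1) G) (clique_free_ideal i G)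
    (mpoly_const ((real p - 1) / 2 * (2 * real i - 3) + real i - 2)
      - (\<Sum>K \<in> cliques (i - 1) H. mpoly_var K))"
proof -
  let ?X = "cliques (i - 1) G" and ?Y = "cliques (i - 1) H" and ?F = "{C. clique_free i G C}"
  have subHG: "subgraph H G" using assms(4) by (simp add: induced_subgraph_def)
  have gH: "graph H"
    using assms(3,4) by (rule graph_induced_subgraph)
  obtain Q :: "nat \<Rightarrow> ('a, 'b) pre_digraph" where
    Q: "\<And>j. j \<in> {1..p} \<Longrightarrow> subgraph (Q j) H \<and> complete_digraph i (Q j)"
    and HQ: "H = pre_digraph.Union H (Q ` {1..p})"
    and Qadj: "\<And>j l. \<lbrakk>j \<in> {1..p}; l \<in> {1..p}; j \<noteq> l\<rbrakk> \<Longrightarrow>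
        (cliques (i - 1) (Q j) \<inter> cliques (i - 1) (Q l) \<noteq> {} \<longleftrightarrow>
         [int j - int l = 1] (mod int p) \<or> [int j - int l = - 1] (mod int p))"
    using assms(5) unfolding clique_hole_def by blast
  define A where "A j = verts (Q (Suc j))" for j
  define N where "N j = {S. S \<subseteq> A j \<and> card S = i - 1}" for j
  have Q': "subgraph (Q (Suc j)) H" "complete_digraph i (Q (Suc j))" if "j < p" for j
    using Q[of "Suc j"] that by auto
  have N: "cliques (i - 1) (Q (Suc j)) = N j" if "j < p" for j
    using cliques_complete_digraph[OF Q'(2)[OF that]] by (simp add: N_def A_def)
  have A: "card (A j) = i" if "j < p" for j
    using Q'(2)[OF that] by (simp add: A_def complete_digraph_def)
  have gQ: "graph (Q (Suc j))" if "j < p" for j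
    using Q'(2)[OF that] by (simp add: complete_digraph_def)
  have adj: "N j \<inter> N l \<noteq> {} \<longleftrightarrow> j = Suc l mod p \<or> l = Suc j mod p"
    if "j < p" "l < p" "j \<noteq> l" for j l
    using Qadj[of "Suc j" "Suc l"] that cong_adjacent_iff[OF that]
    unfolding N[OF that(1)] N[OF that(2)] by simp
  have NY: "N j \<subseteq> ?Y" if "j < p" for j
    using cliques_subgraph_mono[OF gH gQ Q'(1)] that N by blast
  have YX: "?Y \<subseteq> ?X"
    by (rule cliques_subgraph_mono[OF assms(3) gH subHG])
  have Suc_im: "{Suc 0..p} = Suc ` {..<p}"
    by (simp add: lessThan_atLeast0 image_Suc_atLeastLessThan atLeastLessThanSuc_atLeastAtMost)
  have vH: "verts H = (\<Union>j<p. A j)"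
    by (subst HQ) (simp add: pre_digraph.Union_def Suc_im A_def)
  have aH: "arcs H = (\<Union>j<p. arcs (Q (Suc j)))"
    by (subst HQ) (simp add: pre_digraph.Union_def Suc_im)
  \<comment> \<open>An arc of \<open>H\<close> is an arc of some copy; compatibility gives it the
    same ends there, and well-formedness puts them in the copy's vertex set.\<close>
  have pairs: "\<exists>j<p. {u, v} \<subseteq> A j" if uv: "S \<in> ?Y" "u \<in> S" "v \<in> S" "u \<noteq> v" for S u v
  proof -
    have "(u, v) \<in> arcs_ends H" using uv gH by (auto simp: mem_cliques_iff)
    then obtain a where a: "a \<in> arcs H" "u = tail H a" "v = head H a"
      by (auto simp: arcs_ends_def arc_to_ends_def)
    then obtain j where j: "j < p" "a \<in> arcs (Q (Suc j))" using aH by blast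
    have "wf_digraph (Q (Suc j))" "compatible H (Q (Suc j))"
      using Q'(1)[OF j(1)] by (auto simp: subgraph_def)
    then show ?thesis
      using j a by (auto simp: A_def compatible_def wf_digraph_def)
  qed
  have Y_sub: "S \<subseteq> (\<Union>j<p. A j) \<and> card S = i - 1" if "S \<in> ?Y" for S
    using that gH vH by (simp add: mem_cliques_iff)
  have nondeg: "3 \<le> p" "\<And>j l. j < p \<Longrightarrow> l < p \<Longrightarrow> j \<noteq> l \<Longrightarrow> A j \<noteq> A l"
    "\<And>j l m. j < p \<Longrightarrow> l < p \<Longrightarrow> m < p \<Longrightarrow> j \<noteq> l \<Longrightarrow> j \<noteq> m \<Longrightarrow> l \<noteq> m
      \<Longrightarrow> N j \<inter> N l \<inter> N m = {}"
    by (rule hole_nondegenerate[of i p A ?Y, folded N_def];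
        (rule assms A adj NY pairs Y_sub; assumption)?; assumption?)+
  have p3: "3 \<le> p" by (rule nondeg)
  define k where "k = p div 2"
  have k: "p = 2 * k + 1" using assms(2) by (simp add: k_def)
  \<comment> \<open>Chosen so that \<open>h + 1\<close> is half of \<open>i\<close> rounded up; in
    particular \<open>i \<le> 2 * h + 2\<close>.\<close>
  define h where "h = (i - 1) div 2"
  define e where "e j = (SOME L. L \<in> N j \<inter> N (Suc j mod p))" for j
  have cardN: "card (N j) = i" if "j < p" for j
    unfolding N_def using card_subsets_pred[OF A[OF that]] assms(1) by simp
  have deg: "nat \<lceil>real i / 2\<rceil> = h + 1"
  proof -
    have "2 * h + 1 \<le> i" "i \<le> 2 * (h + 1)"
      using assms(1) by (auto simp: h_def)
    then have "real (2 * h + 1) \<le> real i" "real i \<le> real (2 * (h + 1))"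
      by (simp_all only: of_nat_le_iff)
    then have "\<lceil>real i / 2\<rceil> = int (h + 1)"
      by (intro ceiling_unique) auto
    then show ?thesis by simp
  qed
  have finY: "finite ?Y"
    using assms(1,6) p3 by (intro card_ge_0_finite) simp
  have sos: "sos_fun (h + 1) ?X ?F (\<lambda>C. (\<Sum>K\<in>?Y. 1 - char_vec C K) - real (k + 1))"
  proof (rule sos_fun_cyclic_cover[OF k, where N = N and e = e])
    show "1 \<le> k" "1 \<le> h" using p3 k assms(1) by (auto simp: h_def)
    show "finite (N j) \<and> card (N j) \<le> 2 * h + 2" if "j < p" for j
      using cardN[OF that] assms(1) by (auto simp: h_def intro!: card_ge_0_finite)
    show "e j \<in> N j \<inter> N (Suc j mod p)" if "j < p" for j
    proof -
      have "Suc j mod p \<noteq> j" using that p3 by (auto simp: Suc_mod_cases)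
      then have "N j \<inter> N (Suc j mod p) \<noteq> {}" using adj[of j "Suc j mod p"] that by auto
      then show ?thesis unfolding e_def by (rule some_in_eq[THEN iffD2])
    qed
    show "L = M" if "j < p" "l < p" "j \<noteq> l" "L \<in> N j \<inter> N l" "M \<in> N j \<inter> N l" for j l L M
      using common_pred_subset_unique[OF A[OF that(1)] A[OF that(2)] _ nondeg(2)[OF that(1-3)], of L M]
        that(4,5) assms(1) by (auto simp: N_def)
    show "N j \<inter> N l \<inter> N m = {}" if "j < p" "l < p" "m < p" "j \<noteq> l" "j \<noteq> m" "l \<noteq> m" for j l m
      using that by (rule nondeg(3))
    show "j = Suc l mod p \<or> l = Suc j mod p" if "j < p" "l < p" "j \<noteq> l" "N j \<inter> N l \<noteq> {}" for j l
      using adj that by blast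
    show "finite ?Y" by (rule finY)
    show "?Y \<subseteq> ?X" by (rule YX)
    show "N j \<subseteq> ?Y" if "j < p" for j using NY that .
    show "\<not> N j \<subseteq> C" if C: "C \<in> ?F" "j < p" for C j
    proof
      assume sub: "N j \<subseteq> C"
      \<comment> \<open>\<open>A j\<close> is a clique of \<open>G\<close>, so \<open>C\<close>
        misses one of its subcliques of size \<open>i - 1\<close>, and that one belongs to
        \<open>N j\<close>.\<close>
      have "A j \<in> cliques i (Q (Suc j))"
        using cliques_complete_digraph[OF Q'(2)] A that by (simp add: A_def)
      then have "A j \<in> cliques i G"
        using cliques_subgraph_mono[OF gH gQ Q'(1)] cliques_subgraph_mono[OF assms(3) gH subHG] that
        by blast
      then obtain L where "L \<in> ?X" "L \<subset> A j" "L \<notin> C"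
        using C(1) unfolding clique_free_def by blast
      then show False
        using sub assms(3) by (auto simp: mem_cliques_iff N_def)
    qed
  qed
  let ?f = "mpoly_const ((real p - 1) / 2 * (2 * real i - 3) + real i - 2) - (\<Sum>K \<in> ?Y. mpoly_var K)"
  have "?f \<in> mpoly_ring ?X"
    using YX by (intro mpoly_ring_diff mpoly_ring_const mpoly_ring_sum mpoly_ring_var) auto
  moreover have "sos_fun (h + 1) ?X ?F (\<lambda>C. mpoly_eval (char_vec C) ?f)"
  proof (rule sos_fun_cong[OF sos])
    fix C
    \<comment> \<open>With \<open>p = 2 * k + 1\<close> the constant equals
      \<open>p * (i - 1) - (k + 1)\<close>, where \<open>p * (i - 1)\<close> is the number of
      cliques summed over.\<close>
    show "(\<Sum>K\<in>?Y. 1 - char_vec C K) - real (k + 1) = mpoly_eval (char_vec C) ?f"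
      using assms(1,6) k
      by (simp add: sum_subtractf mpoly_eval_diff mpoly_eval_sum mpoly_eval_const mpoly_eval_var
          of_nat_diff field_simps)
  qed
  ultimately show ?thesis
    unfolding deg by (rule sos_mod_clique_free_ideal)
qed

end
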